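(* Let $\kappa_n$ denote the smallest cardinality of a subset $\mathcal{A}\subseteq S_{n+1}$ that covers $S_n$. Then, as $n\to\infty$, $$\frac{(n+1)!}{n^2}(1+o(1))\le \kappa_n\le \frac{\log n}{n^2}(n+1)!\,(1+o(1)).$$
   Context: $S_n$ is the set of all permutations of $[n]=\{1,2,\ldots,n\}$, written as words. A permutation $\rho\in S_{n+1}$ covers $\pi\in S_n$ if $\rho$ has a (not necessarily contiguous) subsequence of length $n$ that is order-isomorphic to $\pi$, i.e. $\rho$ contains $\pi$ as a pattern. A set $\mathcal{A}\subseteq S_{n+1}$ covers $S_n$ if every $\pi\in S_n$ is covered by at least one element of $\mathcal{A}$. $\log$ is the natural logarithm. *)

theory Defs
  imports
    Complex_Main
    "HOL-Library.Landau_Symbols"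
    "HOL-Library.Sublist"
    "HOL-Combinatorics.Multiset_Permutations"
begin

definition perms :: "nat \<Rightarrow> nat list set" where
  "perms n = permutations_of_set {1..n}"

definition order_isomorphic :: "nat list \<Rightarrow> nat list \<Rightarrow> bool" where
  "order_isomorphic xs ys \<longleftrightarrow>
     length xs = length ys \<and>
     (\<forall>i < length xs. \<forall>j < length xs. xs ! i < xs ! j \<longleftrightarrow> ys ! i < ys ! j)"

definition covers :: "nat list \<Rightarrow> nat list \<Rightarrow> bool" where
  "covers \<rho> \<pi> \<longleftrightarrow> (\<exists>\<sigma>. subseq \<sigma> \<rho> \<and> order_isomorphic \<sigma> \<pi>)"

definition covering_set :: "nat \<Rightarrow> nat list set \<Rightarrow> bool" where
  "covering_set n A \<longleftrightarrow>
     A \<subseteq> perms (Suc n) \<and> (\<forall>\<pi> \<in> perms n. \<exists>\<rho> \<in> A. covers \<rho> \<pi>)"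

definition kappa :: "nat \<Rightarrow> nat" where
  "kappa n = (LEAST k. \<exists>A. covering_set n A \<and> card A = k)"

(* The LEAST above ranges over a nonempty set, and over finite sets A only. *)

lemma covering_set_perms: "covering_set n (perms (Suc n))"
  unfolding covering_set_def
proof (intro conjI ballI)
  fix \<pi> assume "\<pi> \<in> perms n"
  then have *: "set \<pi> = {1..n}" "distinct \<pi>"
    by (auto simp: perms_def permutations_of_set_def)
  then have "\<pi> @ [Suc n] \<in> perms (Suc n)"
    by (auto simp: perms_def permutations_of_set_def)
  moreover have "covers (\<pi> @ [Suc n]) \<pi>"
    unfolding covers_def order_isomorphic_def by (intro exI[of _ \<pi>]) (simp add: subseq_rev_drop_many)
  ultimately show "\<exists>\<rho>\<in>perms (Suc n). covers \<rho> \<pi>" by blast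
qed simp

lemma covering_set_finite: "covering_set n A \<Longrightarrow> finite A"
  by (auto simp: covering_set_def perms_def intro: finite_subset)

end

theory Submission
  imports Defs "HOL-Real_Asymp.Real_Asymp"
begin

text \<open>
  Deleting one letter of a permutation in $S_{n+1}$ can be done in $n+1$ ways, so each element of
  $S_{n+1}$ covers at most $n+1$ elements of $S_n$; this gives the lower bound. Conversely every
  element of $S_n$ is covered by at least $n^2+1$ elements of $S_{n+1}$: a value $v$ may be
  inserted at any place, and the resulting words are pairwise distinct once we forbid inserting
  $v \in \{x, x+1\}$ directly in front of a letter $x$. Hence the greedy choice of $k$ elements of
  $S_{n+1}$ leaves at most $n!\,(1-(n^2+1)/(n+1)!)^k$ elements of $S_n$ uncovered, and these are
  then covered one by one; $k \approx (n+1)! \log n / n^2$ gives the upper bound.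
\<close>

section \<open>Greedy coverings\<close>

text \<open>Double counting of the pairs \<open>(x, u)\<close> with \<open>R x u\<close>: each
  \<open>u\<close> lies in at least \<open>d\<close> of them, so the mean over \<open>x\<close> is
  at least the claimed bound.\<close>

lemma exists_above_average:
  fixes R :: "'a \<Rightarrow> 'b \<Rightarrow> bool"
  assumes "finite X" "X \<noteq> {}" "finite U"
    and deg: "\<And>u. u \<in> U \<Longrightarrow> d \<le> card {x \<in> X. R x u}"
  shows "\<exists>x \<in> X. real d * card U / card X \<le> card {u \<in> U. R x u}"
proof (rule ccontr)
  assume "\<not> ?thesis"
  then have less: "real (card {u \<in> U. R x u}) < real d * card U / card X" if "x \<in> X" for x
    using that by force
  have "d * card U = (\<Sum>u\<in>U. d)" by simp
  also have "\<dots> \<le> (\<Sum>u\<in>U. card {x \<in> X. R x u})" by (intro sum_mono deg)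
  also have "\<dots> = (\<Sum>x\<in>X. card {u \<in> U. R x u})"
    by (rule sym, rule sum_multicount_gen) (use assms(1,3) in auto)
  finally have "real (d * card U) \<le> (\<Sum>x\<in>X. real (card {u \<in> U. R x u}))"
    by (metis of_nat_le_iff of_nat_sum)
  also have "\<dots> < (\<Sum>x\<in>X. real d * card U / card X)"
    using assms(1,2) less by (intro sum_strict_mono) auto
  also have "\<dots> = real (d * card U)" using assms(1,2) by simp
  finally show False by simp
qed

text \<open>Each greedy step takes an above-average \<open>x\<close> for the part of
  \<open>U\<close> still uncovered, which shrinks that part by a factor of at most
  \<open>1 - d / card X\<close>.\<close>

lemma greedy_partial_cover:
  fixes R :: "'a \<Rightarrow> 'b \<Rightarrow> bool"
  assumes "finite X" "X \<noteq> {}" "finite U" "d \<le> card X"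
    and deg: "\<And>u. u \<in> U \<Longrightarrow> d \<le> card {x \<in> X. R x u}"
  shows "\<exists>A \<subseteq> X. card A \<le> k \<and>
           real (card {u \<in> U. \<forall>a\<in>A. \<not> R a u}) \<le> card U * (1 - d / card X) ^ k"
proof (induction k)
  case 0
  then show ?case by (intro exI[of _ "{}"]) auto
next
  case (Suc k)
  then obtain A where A: "A \<subseteq> X" "card A \<le> k"
    "real (card {u \<in> U. \<forall>a\<in>A. \<not> R a u}) \<le> card U * (1 - d / card X) ^ k" by blast
  define V where "V = {u \<in> U. \<forall>a\<in>A. \<not> R a u}"
  have V: "finite V" "V \<subseteq> U" using assms(3) by (auto simp: V_def)
  obtain x where x: "x \<in> X" "real d * card V / card X \<le> card {u \<in> V. R x u}"
    using exists_above_average[of X V d R] assms V by blast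
  have "{u \<in> U. \<forall>a\<in>insert x A. \<not> R a u} = V - {u \<in> V. R x u}"
    by (auto simp: V_def)
  then have "real (card {u \<in> U. \<forall>a\<in>insert x A. \<not> R a u}) = card V - real (card {u \<in> V. R x u})"
    using V by (simp add: card_Diff_subset card_mono of_nat_diff)
  also have "\<dots> \<le> card V * (1 - d / card X)"
    using x(2) by (simp add: algebra_simps)
  \<comment> \<open>The induction hypothesis may be multiplied by the new factor because
    \<open>d \<le> card X\<close> keeps that factor nonnegative.\<close>
  also have "\<dots> \<le> (card U * (1 - d / card X) ^ k) * (1 - d / card X)"
    using A(3) assms(4) by (intro mult_right_mono) (auto simp: V_def divide_le_eq_1)
  finally have "real (card {u \<in> U. \<forall>a\<in>insert x A. \<not> R a u}) \<le> card U * (1 - d / card X) ^ Suc k"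
    by (simp add: mult_ac)
  moreover have "card (insert x A) \<le> Suc k"
    using A(2) card_insert_le_m1[of "Suc k" A x] by simp
  ultimately show ?case using A(1) x(1) by (intro exI[of _ "insert x A"]) auto
qed

lemma greedy_cover:
  fixes R :: "'a \<Rightarrow> 'b \<Rightarrow> bool"
  assumes "finite X" "X \<noteq> {}" "finite U" "0 < d" "d \<le> card X"
    and deg: "\<And>u. u \<in> U \<Longrightarrow> d \<le> card {x \<in> X. R x u}"
  shows "\<exists>A \<subseteq> X. (\<forall>u\<in>U. \<exists>a\<in>A. R a u) \<and> real (card A) \<le> k + card U * (1 - d / card X) ^ k"
proof -
  obtain A where A: "A \<subseteq> X" "card A \<le> k"
    "real (card {u \<in> U. \<forall>a\<in>A. \<not> R a u}) \<le> card U * (1 - d / card X) ^ k"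
    using greedy_partial_cover[of X U d R k] assms by blast
  define V where "V = {u \<in> U. \<forall>a\<in>A. \<not> R a u}"
  \<comment> \<open>Positivity of \<open>d\<close> provides a partner for every leftover element, so
    the leftovers can be handled one by one.\<close>
  have "\<exists>x\<in>X. R x u" if "u \<in> V" for u
  proof -
    have "0 < card {x \<in> X. R x u}" using deg[of u] that \<open>0 < d\<close> by (auto simp: V_def)
    then show ?thesis by (auto simp: card_gt_0_iff)
  qed
  then obtain f where f: "f u \<in> X \<and> R (f u) u" if "u \<in> V" for u by metis
  have "card (A \<union> f ` V) \<le> card A + card V"
    using card_Un_le[of A "f ` V"] card_image_le[of V f] assms(3) by (simp add: V_def)
  then have "real (card (A \<union> f ` V)) \<le> k + card U * (1 - d / card X) ^ k"
    using A(2,3) unfolding V_def by linarith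
  moreover have "\<forall>u\<in>U. \<exists>a\<in>A \<union> f ` V. R a u" using f by (auto simp: V_def)
  ultimately show ?thesis using A(1) f by (intro exI[of _ "A \<union> f ` V"]) auto
qed

section \<open>Permutations covered by a given one\<close>

lemma perms_iff: "\<pi> \<in> perms n \<longleftrightarrow> set \<pi> = {1..n} \<and> distinct \<pi>"
  by (auto simp: perms_def permutations_of_set_def)

lemma length_perms: "\<pi> \<in> perms n \<Longrightarrow> length \<pi> = n"
  by (metis perms_iff distinct_card card_atLeastAtMost diff_Suc_1)

lemma finite_perms [simp]: "finite (perms n)"
  by (simp add: perms_def)

lemma card_perms [simp]: "card (perms n) = fact n"
  by (simp add: perms_def)

text \<open>The word of ranks. Only comparisons \<open>xs ! i < xs ! j\<close> enter, which are
  exactly what order-isomorphism preserves; the case \<open>j = i\<close> counts too, so ranks start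
  at 1.\<close>

definition standardize :: "nat list \<Rightarrow> nat list" where
  "standardize xs = map (\<lambda>i. card {j. j < length xs \<and> \<not> xs ! i < xs ! j}) [0..<length xs]"

lemma standardize_cong: "order_isomorphic xs ys \<Longrightarrow> standardize xs = standardize ys"
  unfolding standardize_def order_isomorphic_def
  by (auto intro!: arg_cong[where f = card] Collect_cong)

lemma standardize_perms:
  assumes "\<pi> \<in> perms n"
  shows "standardize \<pi> = \<pi>"
proof (rule nth_equalityI)
  fix i assume "i < length (standardize \<pi>)"
  then have i: "i < n" using length_perms[OF assms] by (simp add: standardize_def)
  have \<pi>: "set \<pi> = {1..n}" "distinct \<pi>" "length \<pi> = n"
    using assms length_perms by (auto simp: perms_iff)
  have le: "\<pi> ! i \<le> n" using \<pi> i nth_mem[of i \<pi>] by auto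
  \<comment> \<open>Counting positions is turned into counting letters: the letters up to
    \<open>\<pi> ! i\<close> are precisely 1, ..., \<open>\<pi> ! i\<close>.\<close>
  have "(!) \<pi> ` {j. j < n \<and> \<not> \<pi> ! i < \<pi> ! j} = {x \<in> set \<pi>. x \<le> \<pi> ! i}"
    using \<pi>(3) by (auto simp: in_set_conv_nth)
  also have "\<dots> = {1..\<pi> ! i}" using \<pi>(1) le by auto
  finally have "card ((!) \<pi> ` {j. j < n \<and> \<not> \<pi> ! i < \<pi> ! j}) = \<pi> ! i" by simp
  moreover have "inj_on ((!) \<pi>) {j. j < n \<and> \<not> \<pi> ! i < \<pi> ! j}"
    using \<pi>(2,3) by (auto simp: inj_on_def nth_eq_iff_index_eq)
  ultimately have "card {j. j < n \<and> \<not> \<pi> ! i < \<pi> ! j} = \<pi> ! i" by (simp add: card_image)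
  then show "standardize \<pi> ! i = \<pi> ! i" using i \<pi>(3) by (simp add: standardize_def)
qed (simp add: standardize_def)

lemma subseq_delete_one:
  assumes "subseq xs ys" "length ys = Suc (length xs)"
  shows "\<exists>i < length ys. xs = take i ys @ drop (Suc i) ys"
  using assms
proof (induction ys arbitrary: xs rule: list.induct)
  case Nil
  then show ?case by simp
next
  case (Cons y ys)
  show ?case
  \<comment> \<open>If \<open>xs\<close> embeds in the tail, the lengths force equality and the head
    is the deleted letter; otherwise the head is matched and the deletion happens in the
    tail.\<close>
  proof (cases "subseq xs ys")
    case True
    then have "xs = ys" using Cons.prems subseq_same_length by force
    then show ?thesis by (intro exI[of _ 0]) simp
  next
    case False
    obtain xs' where xs': "xs = y # xs'" "subseq xs' ys"
      using Cons.prems(1) False by (auto elim: list_emb.cases)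
    have "length ys = Suc (length xs')" using Cons.prems(2) xs'(1) by simp
    from Cons.IH[OF xs'(2) this] obtain i
      where "i < length ys" "xs' = take i ys @ drop (Suc i) ys" by blast
    then show ?thesis using xs' by (intro exI[of _ "Suc i"]) simp
  qed
qed

text \<open>A covered permutation is its own standardization, hence that of the pattern in
  \<open>\<rho>\<close>, and this pattern is one of the \<open>Suc n\<close> one-letter
  deletions.\<close>

lemma card_covered_le:
  assumes "\<rho> \<in> perms (Suc n)"
  shows "card {\<pi> \<in> perms n. covers \<rho> \<pi>} \<le> Suc n"
proof -
  let ?f = "\<lambda>i. standardize (take i \<rho> @ drop (Suc i) \<rho>)"
  have "{\<pi> \<in> perms n. covers \<rho> \<pi>} \<subseteq> ?f ` {..<Suc n}"
  proof
    fix \<pi> assume "\<pi> \<in> {\<pi> \<in> perms n. covers \<rho> \<pi>}"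
    then obtain \<sigma> where \<sigma>: "\<pi> \<in> perms n" "subseq \<sigma> \<rho>" "order_isomorphic \<sigma> \<pi>"
      by (auto simp: covers_def)
    then have "length \<rho> = Suc (length \<sigma>)"
      using length_perms[OF assms] length_perms[OF \<sigma>(1)] by (simp add: order_isomorphic_def)
    then obtain i where "i < length \<rho>" "\<sigma> = take i \<rho> @ drop (Suc i) \<rho>"
      using subseq_delete_one \<sigma>(2) by blast
    moreover have "\<pi> = standardize \<sigma>"
      using standardize_cong[OF \<sigma>(3)] standardize_perms[OF \<sigma>(1)] by simp
    ultimately show "\<pi> \<in> ?f ` {..<Suc n}" using length_perms[OF assms] by auto
  qed
  then show ?thesis
    using surj_card_le[OF finite_lessThan, of _ ?f "Suc n"] by simp
qed

section \<open>Permutations covering a given one\<close>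

text \<open>The increasing relabelling that frees the value \<open>v\<close>.\<close>

definition shift :: "nat \<Rightarrow> nat \<Rightarrow> nat" where
  "shift v x = (if x < v then x else Suc x)"

definition insert_at :: "nat list \<Rightarrow> nat \<Rightarrow> nat \<Rightarrow> nat list" where
  "insert_at xs i v = map (shift v) (take i xs) @ v # map (shift v) (drop i xs)"

lemma shift_less_iff [simp]: "shift v x < shift v y \<longleftrightarrow> x < y"
  by (auto simp: shift_def)

lemma shift_eq_iff [simp]: "shift v x = shift v y \<longleftrightarrow> x = y"
  by (auto simp: shift_def)

lemma shift_neq [simp]: "shift v x \<noteq> v" "v \<noteq> shift v x"
  by (auto simp: shift_def)

lemma shift_cases: "shift v x = x \<or> shift v x = Suc x"
  by (auto simp: shift_def)

lemma insert_at_nth_self: "i \<le> length xs \<Longrightarrow> insert_at xs i v ! i = v"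
  by (simp add: insert_at_def nth_append)

lemma insert_at_nth_less: "j < i \<Longrightarrow> i \<le> length xs \<Longrightarrow> insert_at xs i v ! j = shift v (xs ! j)"
  by (simp add: insert_at_def nth_append)

lemma insert_at_perms:
  assumes "\<pi> \<in> perms n" "v \<in> {1..Suc n}"
  shows "insert_at \<pi> i v \<in> perms (Suc n)"
proof -
  have \<pi>: "set \<pi> = {1..n}" "distinct \<pi>" using assms by (auto simp: perms_iff)
  have "distinct (map (shift v) \<pi>)" using \<pi>(2) by (simp add: distinct_map inj_on_def)
  moreover have "map (shift v) \<pi> = map (shift v) (take i \<pi>) @ map (shift v) (drop i \<pi>)"
    by (metis append_take_drop_id map_append)
  ultimately have "distinct (insert_at \<pi> i v)"
    by (auto simp: insert_at_def)
  moreover have "set (insert_at \<pi> i v) = insert v (shift v ` set \<pi>)"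
    by (metis insert_at_def append_take_drop_id image_Un list.set(2) set_append set_map Un_insert_right)
  moreover have "insert v (shift v ` {1..n}) = {1..Suc n}"
  proof (intro equalityI subsetI)
    fix y assume y: "y \<in> {1..Suc n}"
    consider "y < v" | "y = v" | "v < y" by linarith
    then show "y \<in> insert v (shift v ` {1..n})"
    proof cases
      case 1
      then have "y = shift v y" "y \<in> {1..n}" using y assms(2) by (auto simp: shift_def)
      then show ?thesis by blast
    next
      case 3
      then have "y = shift v (y - 1)" "y - 1 \<in> {1..n}" using y assms(2) by (auto simp: shift_def)
      then show ?thesis by blast
    qed simp
  qed (use assms(2) in \<open>auto simp: shift_def\<close>)
  ultimately show ?thesis using \<pi>(1) by (simp add: perms_iff)
qed

lemma covers_insert_at: "covers (insert_at \<pi> i v) \<pi>"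
proof -
  have "subseq (map (shift v) (take i \<pi>) @ map (shift v) (drop i \<pi>)) (insert_at \<pi> i v)"
    unfolding insert_at_def by (intro list_emb_append_mono list_emb_Cons) auto
  then have "subseq (map (shift v) \<pi>) (insert_at \<pi> i v)"
    by (metis append_take_drop_id map_append)
  then show ?thesis unfolding covers_def order_isomorphic_def by force
qed

text \<open>In a permutation, inserting \<open>x\<close> or \<open>x + 1\<close> directly before the
  letter \<open>x\<close> gives the same word as inserting \<open>x + 1\<close> or \<open>x\<close>,
  respectively, directly after it. The earlier place is discarded; the last place has no following
  letter and keeps all values.\<close>

definition insertions :: "nat list \<Rightarrow> (nat \<times> nat) set" where
  "insertions xs = (SIGMA i:{..length xs}.
     {1..Suc (length xs)} - (if i < length xs then {xs ! i, Suc (xs ! i)} else {}))"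

text \<open>If $\rho$ arises from insertions at places $i < i'$, then $\rho_i$ is both the letter inserted
  at $i$ and the shifted letter $\pi_i$, i.e. $\pi_i$ or $\pi_i + 1$.\<close>

lemma inj_on_insert_at: "inj_on (\<lambda>(i, v). insert_at xs i v) (insertions xs)"
proof -
  have neq: "insert_at xs i v \<noteq> insert_at xs i' v'"
    if "(i, v) \<in> insertions xs" "(i', v') \<in> insertions xs" "i < i'" for i v i' v'
  proof
    assume eq: "insert_at xs i v = insert_at xs i' v'"
    have i': "i' \<le> length xs" using that(2) by (simp add: insertions_def)
    have "v = insert_at xs i v ! i" using that(3) i' by (simp add: insert_at_nth_self)
    also have "\<dots> = shift v' (xs ! i)" using eq that(3) i' by (simp add: insert_at_nth_less)
    finally have "v \<in> {xs ! i, Suc (xs ! i)}" using shift_cases[of v' "xs ! i"] by auto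
    then show False using that(1,3) i' by (auto simp: insertions_def)
  qed
  have eq: "v = v'" if "(i, v) \<in> insertions xs" "insert_at xs i v = insert_at xs i v'" for i v v'
  proof -
    have "i \<le> length xs" using that(1) by (simp add: insertions_def)
    then show ?thesis using that(2) by (metis insert_at_nth_self)
  qed
  show ?thesis
  proof (intro inj_onI, clarsimp)
    fix i v i' v'
    assume *: "(i, v) \<in> insertions xs" "(i', v') \<in> insertions xs"
      "insert_at xs i v = insert_at xs i' v'"
    then have "i = i'" using neq[of i v i' v'] neq[of i' v' i v] by (metis linorder_neqE_nat)
    then show "i = i' \<and> v = v'" using eq[of i v v'] * by simp
  qed
qed

text \<open>Each of the \<open>n\<close> places before a letter loses two of the
  \<open>n + 1\<close> values and the last place loses none: n(n-1) + (n+1) in total.\<close>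

lemma card_insertions:
  assumes "\<pi> \<in> perms n"
  shows "card (insertions \<pi>) = n\<^sup>2 + 1"
proof -
  note [simp] = length_perms[OF assms]
  have *: "card ({1..Suc n} - {\<pi> ! i, Suc (\<pi> ! i)}) = n - 1" if "i < n" for i
  proof -
    have "\<pi> ! i \<in> {1..n}" using assms that by (metis nth_mem perms_iff length_perms)
    then have "card ({1..Suc n} - {\<pi> ! i, Suc (\<pi> ! i)}) = card {1..Suc n} - card {\<pi> ! i, Suc (\<pi> ! i)}"
      by (intro card_Diff_subset) auto
    then show ?thesis by simp
  qed
  have "card (insertions \<pi>) = (\<Sum>i\<le>n. card ({1..Suc n} - (if i < n then {\<pi> ! i, Suc (\<pi> ! i)} else {})))"
    by (simp add: insertions_def)
  also have "\<dots> = (\<Sum>i<n. n - 1) + Suc n"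
  proof -
    have "(\<Sum>i<n. card ({1..Suc n} - (if i < n then {\<pi> ! i, Suc (\<pi> ! i)} else {}))) = (\<Sum>i<n. n - 1)"
      by (intro sum.cong) (auto simp only: * if_True lessThan_iff)
    then show ?thesis by (simp add: lessThan_Suc_atMost[symmetric])
  qed
  \<comment> \<open>The case split deals with the truncated \<open>n - 1\<close> at
    \<open>n = 0\<close>.\<close>
  also have "\<dots> = n\<^sup>2 + 1" by (cases n) (auto simp: power2_eq_square)
  finally show ?thesis .
qed

lemma card_covering_ge:
  assumes "\<pi> \<in> perms n"
  shows "n\<^sup>2 + 1 \<le> card {\<rho> \<in> perms (Suc n). covers \<rho> \<pi>}"
proof -
  have "(\<lambda>(i, v). insert_at \<pi> i v) ` insertions \<pi> \<subseteq> {\<rho> \<in> perms (Suc n). covers \<rho> \<pi>}"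
    using assms length_perms[OF assms]
    by (auto simp: insertions_def covers_insert_at intro!: insert_at_perms)
  then have "card (insertions \<pi>) \<le> card {\<rho> \<in> perms (Suc n). covers \<rho> \<pi>}"
    using card_inj_on_le[OF inj_on_insert_at] by simp
  then show ?thesis using card_insertions[OF assms] by simp
qed

section \<open>Bounds on the covering number\<close>

lemma kappa_le: "covering_set n A \<Longrightarrow> kappa n \<le> card A"
  unfolding kappa_def by (intro Least_le) blast

lemma kappa_attained: "\<exists>A. covering_set n A \<and> card A = kappa n"
  unfolding kappa_def by (rule LeastI_ex) (use covering_set_perms in blast)

text \<open>An optimal covering set splits \<open>perms n\<close> into \<open>kappa n\<close>
  possibly overlapping pieces of size at most \<open>Suc n\<close>.\<close>

lemma fact_le_kappa: "fact n \<le> Suc n * kappa n"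
proof -
  obtain A where A: "covering_set n A" "card A = kappa n" using kappa_attained by blast
  have "perms n = (\<Union>\<rho>\<in>A. {\<pi> \<in> perms n. covers \<rho> \<pi>})"
    using A(1) by (auto simp: covering_set_def)
  then have "fact n \<le> (\<Sum>\<rho>\<in>A. card {\<pi> \<in> perms n. covers \<rho> \<pi>})"
    using card_UN_le[OF covering_set_finite[OF A(1)], of "\<lambda>\<rho>. {\<pi> \<in> perms n. covers \<rho> \<pi>}"]
    by (metis card_perms)
  also have "\<dots> \<le> (\<Sum>\<rho>\<in>A. Suc n)"
    using A(1) by (intro sum_mono card_covered_le) (auto simp: covering_set_def)
  finally show ?thesis using A(2) by (simp add: mult.commute)
qed

text \<open>The greedy bound with \<open>d = n\<^sup>2 + 1\<close>, simplified by 1 - x \<le>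
  exp(-x). The number \<open>k\<close> of greedy steps stays free, to be optimized
  afterwards.\<close>

lemma kappa_greedy_le:
  "real (kappa n) \<le> k + fact n * exp (- (real n)\<^sup>2 / fact (Suc n)) ^ k"
proof -
  \<comment> \<open>The coverers of any single permutation lie in \<open>perms (Suc n)\<close>,
    which yields \<open>d \<le> card X\<close> without estimating factorials.\<close>
  have "\<exists>\<pi>. \<pi> \<in> perms n" by (metis card_perms card.empty fact_nonzero equals0I)
  then have le: "n\<^sup>2 + 1 \<le> fact (Suc n)"
    using card_covering_ge card_mono[of "perms (Suc n)" "{\<rho> \<in> perms (Suc n). covers \<rho> _}"]
    by (auto simp del: fact_Suc intro: order_trans)
  have ne: "perms (Suc n) \<noteq> {}" by (metis card_perms card.empty fact_nonzero)
  obtain A where A: "A \<subseteq> perms (Suc n)" "\<forall>\<pi>\<in>perms n. \<exists>\<rho>\<in>A. covers \<rho> \<pi>"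
    "real (card A) \<le> k + card (perms n) * (1 - (n\<^sup>2 + 1) / card (perms (Suc n))) ^ k"
    using greedy_cover[of "perms (Suc n)" "perms n" "n\<^sup>2 + 1" covers k] ne le card_covering_ge
    by (auto simp del: fact_Suc)
  have "real (kappa n) \<le> k + fact n * (1 - (real n ^ 2 + 1) / fact (Suc n)) ^ k"
    using kappa_le[of n A] A by (simp add: covering_set_def add.commute del: fact_Suc)
  moreover have "(1 - (real n ^ 2 + 1) / fact (Suc n)) ^ k \<le> exp (- (real n)\<^sup>2 / fact (Suc n)) ^ k"
  proof (rule power_mono)
    have "real (n\<^sup>2 + 1) \<le> real (fact (Suc n))" using le by (simp only: of_nat_le_iff)
    then show "0 \<le> 1 - (real n ^ 2 + 1) / fact (Suc n)"
      by (simp add: divide_le_eq_1 del: fact_Suc)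
    \<comment> \<open>The summand 1 is given up here to obtain a cleaner exponent.\<close>
    have "(real n)\<^sup>2 / fact (Suc n) \<le> (real n ^ 2 + 1) / fact (Suc n)"
      by (intro divide_right_mono) auto
    then show "1 - (real n ^ 2 + 1) / fact (Suc n) \<le> exp (- (real n)\<^sup>2 / fact (Suc n))"
      using exp_ge_add_one_self[of "- (real n)\<^sup>2 / fact (Suc n)"] by (simp del: fact_Suc)
  qed
  then have "fact n * (1 - (real n ^ 2 + 1) / fact (Suc n)) ^ k
      \<le> fact n * exp (- (real n)\<^sup>2 / fact (Suc n)) ^ k"
    by (intro mult_left_mono) auto
  ultimately show ?thesis by linarith
qed

text \<open>The left side is \<open>fact n / (real n + 1)\<close>, written so that the relative
  error \<open>(real n)\<^sup>2 / (real n + 1)\<^sup>2 - 1\<close> is visible.\<close>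

lemma kappa_lower:
  assumes "n \<ge> 1"
  shows "fact (n + 1) / (real n)\<^sup>2 * (1 + ((real n)\<^sup>2 / (real n + 1)\<^sup>2 - 1)) \<le> real (kappa n)"
proof -
  have "real (fact n) \<le> real (Suc n * kappa n)" using fact_le_kappa by (simp only: of_nat_le_iff)
  then have "fact n / (real n + 1) \<le> real (kappa n)"
    by (simp add: divide_le_eq algebra_simps)
  moreover have "fact (n + 1) / (real n)\<^sup>2 * (1 + ((real n)\<^sup>2 / (real n + 1)\<^sup>2 - 1)) = fact n / (real n + 1)"
  proof -
    have "fact (n + 1) = (real n + 1) * fact n" by simp
    moreover have "real n + 1 \<noteq> 0" "real n \<noteq> 0" using assms by auto
    ultimately show ?thesis by (simp add: power2_eq_square del: fact_Suc)
  qed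
  ultimately show ?thesis by simp
qed

lemma kappa_upper:
  assumes "n \<ge> 2"
  shows "real (kappa n) \<le> ln (real n) / (real n)\<^sup>2 * fact (n + 1) * (1 + 2 / ln (real n))"
proof -
  define M where "M = (fact (n + 1) :: real)"
  \<comment> \<open>The least number of greedy steps that brings the uncovered fraction bound
    \<open>exp (- (real n)\<^sup>2 / M) ^ k\<close> down to 1/n.\<close>
  define k where "k = nat \<lceil>M * ln n / (real n)\<^sup>2\<rceil>"
  have M: "M > 0" "M = (real n + 1) * fact n" by (simp_all add: M_def)
  have ln: "ln (real n) > 0" using assms by simp
  have "M * ln n / (real n)\<^sup>2 \<ge> 0" using M ln by simp
  then have k: "M * ln n / (real n)\<^sup>2 \<le> k" "k \<le> M * ln n / (real n)\<^sup>2 + 1"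
    unfolding k_def by linarith+
  have "ln n \<le> k * ((real n)\<^sup>2 / M)"
    using k(1) M assms by (simp add: field_simps)
  then have "exp (k * (- (real n)\<^sup>2 / M)) \<le> exp (- ln n)" by simp
  then have "exp (- (real n)\<^sup>2 / M) ^ k \<le> exp (- ln n)"
    by (simp only: exp_of_nat_mult)
  then have "exp (- (real n)\<^sup>2 / M) ^ k \<le> 1 / n"
    using assms by (simp add: exp_minus[of "ln n"] inverse_eq_divide)
  then have "fact n * exp (- (real n)\<^sup>2 / M) ^ k \<le> fact n * (1 / n)"
    by (intro mult_left_mono) auto
  then have "real (kappa n) \<le> M * ln n / (real n)\<^sup>2 + (1 + fact n / n)"
    using kappa_greedy_le[of n k] k(2) by (simp add: M_def del: fact_Suc)
  \<comment> \<open>The rounding error 1 and the leftover \<open>fact n / n\<close> are each at most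
    \<open>M / (real n)\<^sup>2\<close>, hence the constant 2; relative to the main term this is
    \<open>2 / ln (real n)\<close>.\<close>
  also have "1 + fact n / n \<le> 2 * M / (real n)\<^sup>2"
  proof -
    have "real n \<le> fact n" by (metis fact_ge_self of_nat_fact of_nat_le_iff)
    then have "real n * real n \<le> (real n + 1) * fact n" by (intro mult_mono) auto
    moreover have "real n * fact n \<le> (real n + 1) * fact n" by (intro mult_right_mono) auto
    ultimately have "(real n)\<^sup>2 + real n * fact n \<le> 2 * M"
      unfolding M(2) power2_eq_square by linarith
    then have "((real n)\<^sup>2 + real n * fact n) / (real n)\<^sup>2 \<le> 2 * M / (real n)\<^sup>2"
      by (intro divide_right_mono) auto
    then show ?thesis using assms by (simp add: add_divide_distrib power2_eq_square)
  qed
  also have "M * ln n / (real n)\<^sup>2 + 2 * M / (real n)\<^sup>2 = ln (real n) / (real n)\<^sup>2 * M * (1 + 2 / ln (real n))"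
    using ln assms by (simp add: field_simps)
  finally show ?thesis by (simp add: M_def)
qed

theorem theorem2:
  shows "\<exists>\<epsilon> \<delta> :: nat \<Rightarrow> real.
           \<epsilon> \<in> o(\<lambda>_. 1) \<and> \<delta> \<in> o(\<lambda>_. 1) \<and>
           (\<forall>\<^sub>F n in sequentially.
              fact (n + 1) / (real n)\<^sup>2 * (1 + \<epsilon> n) \<le> real (kappa n) \<and>
              real (kappa n) \<le> ln (real n) / (real n)\<^sup>2 * fact (n + 1) * (1 + \<delta> n))"
proof (intro exI conjI)
  \<comment> \<open>The witnesses are the explicit relative errors from \<open>kappa_lower\<close>
    and \<open>kappa_upper\<close>.\<close>
  show "(\<lambda>n. (real n)\<^sup>2 / (real n + 1)\<^sup>2 - 1) \<in> o(\<lambda>_. 1)" by real_asymp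
  show "(\<lambda>n. 2 / ln (real n)) \<in> o(\<lambda>_. 1)" by real_asymp
  show "\<forall>\<^sub>F n in sequentially.
      fact (n + 1) / (real n)\<^sup>2 * (1 + ((real n)\<^sup>2 / (real n + 1)\<^sup>2 - 1)) \<le> real (kappa n) \<and>
      real (kappa n) \<le> ln (real n) / (real n)\<^sup>2 * fact (n + 1) * (1 + 2 / ln (real n))"
    using eventually_ge_at_top[of 2] by eventually_elim (intro conjI kappa_lower kappa_upper; simp)
qed

end
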